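(* Let $\Gamma,A,B$ be linear chains and let $\Gamma\to A$, $\Gamma\to B$ be a relatively minimal pair of dominations. Fix an ordering of $\Gamma$ and order $A$ and $B$ accordingly. Assume that $A$ and $B$ are standard and that at least one of them is different from $[[0_{2k+1}]]$ for all $k\ge 0$. If the groups of zeros in $A$ and in $B$ are both on the left (with respect to these orderings), then $\Gamma\to A$ and $\Gamma\to B$ are isomorphisms.
   Context: A linear chain $[[w_0,\dots,w_n]]$ is a (nonempty) path graph with linearly ordered consecutive vertices $v_0<\dots<v_n$ carrying integer weights $w_i=v_i^2$. Inside brackets $0_m$ denotes $m$ consecutive entries $0$. A linear chain is standard if, for a suitable orientation, it is one of $[[0_{2k},w_1,\dots,w_n]]$ or $[[0_{2k+1}]]$ with $k,n\ge 0$ and all $w_i\le -2$; its group of zeros is on the left if it has this form in the given ordering. An inner blowup of a weighted graph at an edge $e$ with end points $v_0\ne v_1$ subdivides $e$ by a new vertex of weight $-1$ and decreases the weights of $v_0,v_1$ by $1$. An outer blowup at a vertex $v_0$ adds a new vertex of weight $-1$ joined to $v_0$ by one new edge and decreases the weight of $v_0$ by $1$. The inverse operations are blowdowns. A domination $\Gamma\to\Gamma'$ means that $\Gamma$ is obtained from $\Gamma'$ by a finite (possibly empty) sequence of blowups; the vertices of $\Gamma$ not corresponding to vertices of $\Gamma'$ are said to be contracted in $\Gamma'$. The vertices of $\Gamma'$ are identified with their proper transforms in $\Gamma$, so an ordering of the chain $\Gamma$ induces orderings of $A$ and $B$. The domination is an isomorphism if no vertex is contracted. A pair of dominations $\Gamma\to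 A$, $\Gamma\to B$ is relatively minimal if no vertex of $\Gamma$ of weight $-1$ and degree $\le 2$ is contracted in both $A$ and $B$. *)

theory Defs
  imports Main
begin

text \<open>
  Finite simple graphs with integer vertex weights.  Blowups of a simple graph are again simple,
  so loops and multiple edges never arise over a linear chain.  The vertex set is the domain of
  the partial map \<open>wt\<close>, so that no weights are recorded outside the graph and equality of
  records is equality of weighted graphs.
\<close>

record 'a wgraph =
  wt :: "'a \<rightharpoonup> int"
  edges :: "'a set set"

definition verts :: "'a wgraph \<Rightarrow> 'a set" where
  "verts G = dom (wt G)"

definition weight :: "'a wgraph \<Rightarrow> 'a \<Rightarrow> int" where
  "weight G v = the (wt G v)"

definition degree :: "'a wgraph \<Rightarrow> 'a \<Rightarrow> nat" where
  "degree G v = card {e \<in> edges G. v \<in> e}"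

text \<open>The list \<open>vs\<close> is an ordering \<open>v\<^sub>0 < \<dots> < v\<^sub>n\<close> of the vertices exhibiting \<open>G\<close> as a path.\<close>

definition chain_ordering :: "'a wgraph \<Rightarrow> 'a list \<Rightarrow> bool" where
  "chain_ordering G vs \<longleftrightarrow>
     vs \<noteq> [] \<and> distinct vs \<and> set vs = verts G \<and>
     edges G = {{vs ! i, vs ! Suc i} | i. Suc i < length vs}"

definition linear_chain :: "'a wgraph \<Rightarrow> bool" where
  "linear_chain G \<longleftrightarrow> (\<exists>vs. chain_ordering G vs)"

text \<open>\<open>G\<close> is the chain \<open>[[ws]]\<close> for at least one of its (at most two) orderings.\<close>

definition is_chain :: "'a wgraph \<Rightarrow> int list \<Rightarrow> bool" where
  "is_chain G ws \<longleftrightarrow> (\<exists>vs. chain_ordering G vs \<and> map (weight G) vs = ws)"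

definition standard_left :: "int list \<Rightarrow> bool" where
  "standard_left ws \<longleftrightarrow>
     (\<exists>k us. ws = replicate (2 * k) 0 @ us \<and> (\<forall>w \<in> set us. w \<le> -2)) \<or>
     (\<exists>k. ws = replicate (2 * k + 1) 0)"

definition standard :: "'a wgraph \<Rightarrow> bool" where
  "standard G \<longleftrightarrow> (\<exists>ws. is_chain G ws \<and> standard_left ws)"

text \<open>
  A blowup keeps the names of the old vertices: a vertex is identified with its proper transform.
\<close>

inductive blowup :: "'a wgraph \<Rightarrow> 'a wgraph \<Rightarrow> bool" where
  inner: "{u, v} \<in> edges G \<Longrightarrow> u \<in> verts G \<Longrightarrow> v \<in> verts G \<Longrightarrow> u \<noteq> v \<Longrightarrow> x \<notin> verts G \<Longrightarrow>
    blowup G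
      \<lparr>wt = (wt G)(u \<mapsto> weight G u - 1, v \<mapsto> weight G v - 1, x \<mapsto> -1),
       edges = (edges G - {{u, v}}) \<union> {{u, x}, {x, v}}\<rparr>"
| outer: "v \<in> verts G \<Longrightarrow> x \<notin> verts G \<Longrightarrow>
    blowup G
      \<lparr>wt = (wt G)(v \<mapsto> weight G v - 1, x \<mapsto> -1),
       edges = edges G \<union> {{v, x}}\<rparr>"

text \<open>
  \<open>dominates G H\<close> is the existence of a domination \<open>G \<rightarrow> H\<close>, the vertices of \<open>H\<close> being
  literally vertices of \<open>G\<close>.
\<close>

definition dominates :: "'a wgraph \<Rightarrow> 'a wgraph \<Rightarrow> bool" where
  "dominates G H \<longleftrightarrow> blowup\<^sup>*\<^sup>* H G"

definition contracted :: "'a wgraph \<Rightarrow> 'a wgraph \<Rightarrow> 'a set" where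
  "contracted G H = verts G - verts H"

definition relatively_minimal :: "'a wgraph \<Rightarrow> 'a wgraph \<Rightarrow> 'a wgraph \<Rightarrow> bool" where
  "relatively_minimal G A B \<longleftrightarrow>
     \<not> (\<exists>v \<in> verts G. weight G v = -1 \<and> degree G v \<le> 2 \<and>
          v \<in> contracted G A \<and> v \<in> contracted G B)"

text \<open>A domination \<open>G \<rightarrow> H\<close> is an isomorphism if no vertex is contracted.\<close>

definition domination_iso :: "'a wgraph \<Rightarrow> 'a wgraph \<Rightarrow> bool" where
  "domination_iso G H \<longleftrightarrow> dominates G H \<and> contracted G H = {}"

text \<open>The ordering of the vertices of \<open>H\<close> induced by an ordering of a graph dominating \<open>H\<close>.\<close>

definition induced_ordering :: "'a list \<Rightarrow> 'a wgraph \<Rightarrow> 'a list" where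
  "induced_ordering vs H = filter (\<lambda>v. v \<in> verts H) vs"

definition zeros_on_left :: "'a wgraph \<Rightarrow> 'a list \<Rightarrow> bool" where
  "zeros_on_left H vs \<longleftrightarrow> standard_left (map (weight H) vs)"

end

theory Submission
  imports Defs
begin

text \<open>
  As for toric surfaces, attach to the vertices of \<open>\<Gamma>\<close>, and to one extra vertex beyond each end,
  vectors \<open>p\<^sub>i = (f\<^sub>i, g\<^sub>i)\<close> with \<open>p\<^sub>i\<^sub>-\<^sub>1 + p\<^sub>i\<^sub>+\<^sub>1 = - w\<^sub>i p\<^sub>i\<close>.  Every blowup then inserts the sum
  of two consecutive vectors, so the restrictions of \<open>p\<close> to \<open>A\<close> and to \<open>B\<close> satisfy the same
  recursion.  Normalise \<open>f = 0\<close> at the left extra vertex.  If all weights of \<open>A\<close> are \<open>\<le> -2\<close>, then \<open>f\<close>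
  has no further zero, while a pair of leading zero weights makes its second vertex \<open>z\<close> the first
  further zero of \<open>f\<close>, with \<open>p\<^sub>z\<close> the negative of the initial vector.  Hence \<open>A\<close> and \<open>B\<close> share \<open>z\<close>,
  and induction applies to the right of \<open>z\<close>.  There \<open>A\<close> and \<open>B\<close> agree, so the vectors of their first
  vertices agree, and so do these vertices.  Finally, a \<open>-1\<close> vertex contracted in \<open>A\<close> would survive
  in \<open>B\<close> with weight \<open>\<ge> -1\<close>, which is impossible once the groups of zeros coincide.
\<close>

section \<open>Harmonic functions on chains\<close>

fun harmonic :: "('b \<Rightarrow> int) \<Rightarrow> ('b \<Rightarrow> int) \<Rightarrow> 'b list \<Rightarrow> bool" where
  "harmonic w f (a # b # c # L) \<longleftrightarrow> f a + f c = - w b * f b \<and> harmonic w f (b # c # L)"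
| "harmonic w f L \<longleftrightarrow> True"

lemma harmonic_append:
  "harmonic w f (xs @ a # b # ys) \<longleftrightarrow> harmonic w f (xs @ [a, b]) \<and> harmonic w f (a # b # ys)"
proof (induction xs)
  case (Cons x xs)
  then show ?case by (cases xs; cases "tl xs") auto
qed simp

lemma harmonic_ConsD: "harmonic w f (a # L) \<Longrightarrow> harmonic w f L"
  by (cases L; cases "tl L") auto

lemma harmonic_appendD2: "harmonic w f (xs @ L) \<Longrightarrow> harmonic w f L"
  by (induction xs) (auto dest: harmonic_ConsD)

lemma harmonic_appendD1: "harmonic w f (L @ xs) \<Longrightarrow> harmonic w f L"
proof (induction w f L rule: harmonic.induct)
qed auto

lemma harmonic_cong:
  "harmonic w f L \<Longrightarrow> (\<And>b. b \<in> set (butlast (tl L)) \<Longrightarrow> w' b = w b) \<Longrightarrow> harmonic w' f L"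
proof (induction w f L rule: harmonic.induct)
qed auto

lemma harmonic_uminus: "harmonic w f L \<Longrightarrow> harmonic w (\<lambda>x. - f x) L"
  by (induction w f L rule: harmonic.induct) auto

lemma harmonic_exists:
  assumes "distinct (a # b # L)"
  obtains f where "harmonic w f (a # b # L)" "f a = s" "f b = t"
proof -
  have "\<exists>f. harmonic w f (a # b # L) \<and> f a = s \<and> f b = t" using assms
  proof (induction L arbitrary: a b s t)
    case Nil
    then show ?case by (intro exI[of _ "\<lambda>x. if x = a then s else t"]) auto
  next
    case (Cons c L)
    from Cons.prems have "distinct (b # c # L)" by simp
    from Cons.IH[OF this, of t "- w b * t - s"] obtain f where
      f: "harmonic w f (b # c # L)" "f b = t" "f c = - w b * t - s" by auto
    have upd: "harmonic w (f(a := s)) M" if "harmonic w f M" "a \<notin> set M" for M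
      using that by (induction w f M rule: harmonic.induct) auto
    have "harmonic w (f(a := s)) (b # c # L)" using upd[OF f(1)] Cons.prems by simp
    with f Cons.prems show ?case by (intro exI[of _ "f(a := s)"]) (auto simp del: fun_upd_apply simp: fun_upd_same fun_upd_other)
  qed
  with that show ?thesis by blast
qed

text \<open>\<open>fill f g u G v\<close>: repeated insertion of sums between \<open>u\<close> and \<open>v\<close> produces \<open>G\<close>.\<close>

inductive fill :: "('b \<Rightarrow> int) \<Rightarrow> ('b \<Rightarrow> int) \<Rightarrow> 'b \<Rightarrow> 'b list \<Rightarrow> 'b \<Rightarrow> bool" for f g where
  empty: "fill f g u [] v"
| mid: "fill f g u G x \<Longrightarrow> fill f g x H v \<Longrightarrow> f x = f u + f v \<Longrightarrow> g x = g u + g v \<Longrightarrow>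
    fill f g u (G @ x # H) v"

lemma fill_uminus: "fill f g u G v \<Longrightarrow> fill (\<lambda>x. - f x) g u G v"
  by (induction rule: fill.induct) (auto intro: fill.intros)

text \<open>As in the Stern-Brocot tree, positive coefficients survive each insertion. The same
  \<alpha> and \<beta> serve \<open>f\<close> and \<open>g\<close>, so this is an identity between
  vectors.\<close>

lemma fill_combination:
  assumes "fill f g u G v" "c \<in> set G"
  obtains \<alpha> \<beta> where "\<alpha> \<ge> 1" "\<beta> \<ge> 1" "f c = \<alpha> * f u + \<beta> * f v" "g c = \<alpha> * g u + \<beta> * g v"
proof -
  have "\<exists>\<alpha> \<beta>. \<alpha> \<ge> 1 \<and> \<beta> \<ge> 1 \<and> f c = \<alpha> * f u + \<beta> * f v \<and> g c = \<alpha> * g u + \<beta> * g v"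
    using assms
  proof (induction rule: fill.induct)
    case (mid u G x H v)
    from mid.prems consider "c = x" | "c \<in> set G" | "c \<in> set H" by auto
    then show ?case
    proof cases
      case 1
      then show ?thesis using mid.hyps by (intro exI[of _ 1]) auto
    next
      case 2
      then obtain \<alpha> \<beta> where "\<alpha> \<ge> 1" "\<beta> \<ge> 1" "f c = \<alpha> * f u + \<beta> * f x" "g c = \<alpha> * g u + \<beta> * g x"
        using mid.IH by blast
      then show ?thesis using mid.hyps
        by (intro exI[of _ "\<alpha> + \<beta>"] exI[of _ \<beta>]) (auto simp: algebra_simps)
    next
      case 3
      then obtain \<alpha> \<beta> where "\<alpha> \<ge> 1" "\<beta> \<ge> 1" "f c = \<alpha> * f x + \<beta> * f v" "g c = \<alpha> * g x + \<beta> * g v"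
        using mid.IH by blast
      then show ?thesis using mid.hyps
        by (intro exI[of _ \<alpha>] exI[of _ "\<alpha> + \<beta>"]) (auto simp: algebra_simps)
    qed
  qed simp
  with that show ?thesis by blast
qed

lemma fill_pos:
  assumes "fill f g u G v" "f u \<ge> 0" "f v \<ge> 0" "f u > 0 \<or> f v > 0" "c \<in> set G"
  shows "f c > 0"
proof -
  obtain \<alpha> \<beta> where ab: "\<alpha> \<ge> 1" "\<beta> \<ge> 1" "f c = \<alpha> * f u + \<beta> * f v"
    using fill_combination[OF assms(1,5)] by metis
  have "\<alpha> * f u \<ge> f u" "\<beta> * f v \<ge> f v"
    using ab assms(2,3) mult_right_mono[of 1] by fastforce+
  with ab assms show ?thesis by linarith
qed

text \<open>Some insertion has both of its sides left empty; its vertex stays adjacent to its two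
  parents in the final list.\<close>

lemma fill_last_blowup:
  assumes "fill f g u G v" "G \<noteq> []"
  shows "\<exists>xs s x t ys. u # G @ [v] = xs @ s # x # t # ys \<and> x \<in> set G \<and> f x = f s + f t"
  using assms
proof (induction rule: fill.induct)
  case (mid u G x H v)
  show ?case
  proof (cases "G = [] \<and> H = []")
    case True
    with mid.hyps show ?thesis
      by (intro exI[of _ "[]"] exI[of _ u] exI[of _ x] exI[of _ v]) auto
  next
    case False
    then consider "G \<noteq> []" | "H \<noteq> []" by blast
    then show ?thesis
    proof cases
      case 1
      with mid.IH obtain xs s y t ys where
        *: "u # G @ [x] = xs @ s # y # t # ys" "y \<in> set G" "f y = f s + f t" by blast
      from *(1) have "u # (G @ x # H) @ [v] = xs @ s # y # t # (ys @ H @ [v])"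
        by (metis append.assoc append_Cons append_Nil)
      with * show ?thesis by (metis Un_iff set_append)
    next
      case 2
      with mid.IH obtain xs s y t ys where
        *: "x # H @ [v] = xs @ s # y # t # ys" "y \<in> set H" "f y = f s + f t" by blast
      from *(1) have "u # (G @ x # H) @ [v] = (u # G @ xs) @ s # y # t # ys"
        by simp
      with * show ?thesis by (metis Un_iff set_append list.set_intros(2))
    qed
  qed
qed simp

text \<open>The vertex inserted last lies between its two parents, so its weight is \<open>-1\<close>.\<close>

lemma fill_minus_one:
  assumes "fill f g u G v" "G \<noteq> []" "harmonic w f (u # G @ [v])" "\<And>c. c \<in> set G \<Longrightarrow> f c > 0"
  shows "\<exists>x\<in>set G. w x = -1"
proof -
  obtain xs s x t ys where *: "u # G @ [v] = xs @ s # x # t # ys" "x \<in> set G" "f x = f s + f t"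
    using fill_last_blowup[OF assms(1,2)] by blast
  have "harmonic w f (s # x # t # ys)"
    using assms(3) unfolding *(1) by (rule harmonic_appendD2)
  then have "f x = - w x * f x" using *(3) by simp
  then have "(w x + 1) * f x = 0" by (simp add: algebra_simps)
  with assms(4)[OF *(2)] have "w x = -1" by auto
  with *(2) show ?thesis by blast
qed

section \<open>Refinements of a whole chain\<close>

text \<open>A domination seen from the coarse chain: every gap is filled independently and both ends
  stay fixed. Describing gaps instead of an order of insertions permits induction along the
  chain.\<close>

fun refines :: "('b \<Rightarrow> int) \<Rightarrow> ('b \<Rightarrow> int) \<Rightarrow> 'b list \<Rightarrow> 'b list \<Rightarrow> bool" where
  "refines f g [] L \<longleftrightarrow> L = []"
| "refines f g [a] L \<longleftrightarrow> L = [a]"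
| "refines f g (a # b # M) L \<longleftrightarrow> (\<exists>G L'. L = a # G @ L' \<and> fill f g a G b \<and> refines f g (b # M) L')"

lemma refines_refl: "refines f g M M"
proof (induction M rule: induct_list012)
  case (3 a b M)
  then show ?case
    by (simp only: refines.simps, intro exI[of _ "[]"] exI[of _ "b # M"]) (simp add: fill.empty)
qed auto

lemma refines_Cons: "refines f g (a # M) L \<Longrightarrow> \<exists>L'. L = a # L'"
  by (cases M) auto

lemma refines_uminus: "refines f g M L \<Longrightarrow> refines (\<lambda>x. - f x) g M L"
proof (induction f g M L rule: refines.induct)
  case (3 f g a b M L)
  from 3(2) obtain G L' where L: "L = a # G @ L'" "fill f g a G b" "refines f g (b # M) L'"
    by auto
  then show ?case using 3(1)[OF L(3)] fill_uminus[OF L(2)]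
    by (simp only: refines.simps) blast
qed auto

lemma refines_subset: "refines f g M L \<Longrightarrow> set M \<subseteq> set L"
  by (induction f g M L rule: refines.induct) fastforce+

text \<open>Without \<open>x\<close> the gaps on its two sides merge into one, filled by inserting
  \<open>x\<close> first.\<close>

lemma refines_remove:
  assumes "refines f g (xs @ u # x # v # ys) L" "f x = f u + f v" "g x = g u + g v"
  shows "refines f g (xs @ u # v # ys) L"
  using assms
proof (induction xs arbitrary: L)
  case Nil
  then obtain G L' H L'' where "L = u # G @ x # H @ L''" "fill f g u G x" "fill f g x H v"
    "refines f g (v # ys) L''" by auto
  moreover from this have "fill f g u (G @ x # H) v" using Nil by (intro fill.mid)
  ultimately show ?case
    by (simp only: append_Nil refines.simps, intro exI[of _ "G @ x # H"] exI[of _ L'']) simp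
next
  case (Cons a xs)
  then show ?case by (cases xs) fastforce+
qed

lemma refines_pos:
  assumes "refines f g (a # M) L" "f a \<ge> 0" "\<forall>x\<in>set M. f x > 0"
  shows "\<forall>x\<in>set (tl L). f x > 0"
  using assms
proof (induction M arbitrary: a L)
  case (Cons b M)
  then obtain G L' where L: "L = a # G @ L'" "fill f g a G b" "refines f g (b # M) L'" by auto
  have "f b > 0" using Cons.prems by simp
  have "\<forall>x\<in>set (tl L'). f x > 0"
    by (rule Cons.IH[OF L(3) less_imp_le[OF \<open>f b > 0\<close>]]) (simp add: Cons.prems(3))
  moreover have "f c > 0" if "c \<in> set G" for c
    by (rule fill_pos[OF L(2) _ _ _ that]) (use Cons.prems \<open>f b > 0\<close> in auto)
  moreover obtain L'' where "L' = b # L''" using refines_Cons[OF L(3)] by blast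
  ultimately show ?case using L(1) \<open>f b > 0\<close> by auto
qed auto

text \<open>Unequal lists have a nonempty gap, whose last inserted vertex has weight -1;
  distinctness keeps it out of \<open>M\<close>.\<close>

lemma refines_minus_one:
  assumes "refines f g M L" "distinct L" "harmonic w f L" "\<forall>x\<in>set (tl L). f x > 0" "M \<noteq> L"
  shows "\<exists>x\<in>set L. w x = -1 \<and> x \<notin> set M"
  using assms
proof (induction f g M L rule: refines.induct)
  case (3 f g a b M L)
  from 3(2) obtain G L' where L: "L = a # G @ L'" "fill f g a G b" "refines f g (b # M) L'" by auto
  obtain L'' where L': "L' = b # L''" using refines_Cons[OF L(3)] by blast
  have sub: "set (b # M) \<subseteq> set L'" by (rule refines_subset[OF L(3)])
  show ?case
  proof (cases "G = []")
    case False
    have "harmonic w f ((a # G @ [b]) @ L'')" using 3(4) L L' by simp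
    then have "harmonic w f (a # G @ [b])" by (rule harmonic_appendD1)
    then obtain x where "x \<in> set G" "w x = -1"
      using fill_minus_one[OF L(2) False] 3(5) L(1) by auto
    moreover have "x \<notin> set (a # b # M)" using \<open>x \<in> set G\<close> 3(3) sub L(1) by auto
    ultimately show ?thesis using L by auto
  next
    case True
    have "\<exists>x\<in>set L'. w x = -1 \<and> x \<notin> set (b # M)"
    proof (rule 3(1)[OF L(3)])
      show "harmonic w f L'" using 3(4) True L(1) harmonic_ConsD by simp
      show "\<forall>x\<in>set (tl L'). f x > 0" using 3(5) L(1) L' by auto
    qed (use 3 L True in auto)
    then show ?thesis using 3(3) L(1) by auto
  qed
qed auto

section \<open>Effect of weights at most -2 and of pairs of zeros\<close>

text \<open>Such weights give \<open>f c \<ge> 2 * f b - f a > f b\<close>, so an initial increase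
  persists.\<close>

lemma harmonic_increasing:
  assumes "harmonic w f (a # b # T)" "0 \<le> f a" "f a < f b" "\<forall>x\<in>set (butlast (b # T)). w x \<le> -2"
  shows "\<forall>x\<in>set (b # T). f x > 0"
  using assms
proof (induction T arbitrary: a b)
  case (Cons c T)
  have "w b \<le> -2" using Cons.prems by simp
  then have "- w b * f b \<ge> 2 * f b"
    using Cons.prems by (intro mult_right_mono) auto
  then have "f c > f b" using Cons.prems by simp
  have "\<forall>x\<in>set (c # T). f x > 0"
    by (rule Cons.IH[of b c]) (use Cons.prems \<open>f c > f b\<close> in auto)
  then show ?case using Cons.prems by auto
qed auto

text \<open>Zeros are split off in pairs, the unit of the later induction; an odd group ends in a
  single zero.\<close>

lemma standard_left_cases:
  assumes "standard_left ws"
  obtains "\<forall>x\<in>set ws. x \<le> -2" | "ws = [0]" | ws' where "ws = 0 # 0 # ws'" "standard_left ws'"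
proof -
  from assms consider k us where "ws = replicate (2 * k) 0 @ us" "\<forall>w \<in> set us. w \<le> -2"
    | k where "ws = replicate (2 * k + 1) 0" unfolding standard_left_def by blast
  then show ?thesis
  proof cases
    case 1
    show ?thesis
    proof (cases k)
      case 0
      with 1 that(1) show ?thesis by simp
    next
      case (Suc j)
      with 1 have "ws = 0 # 0 # (replicate (2 * j) 0 @ us)" by simp
      moreover have "standard_left (replicate (2 * j) 0 @ us)"
        using 1 unfolding standard_left_def by blast
      ultimately show ?thesis by (rule that(3))
    qed
  next
    case 2
    show ?thesis
    proof (cases k)
      case 0
      with 2 that(2) show ?thesis by simp
    next
      case (Suc j)
      with 2 have "ws = 0 # 0 # replicate (2 * j + 1) 0" by simp
      moreover have "standard_left (replicate (2 * j + 1) 0)"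
        unfolding standard_left_def by blast
      ultimately show ?thesis by (rule that(3))
    qed
  qed
qed

section \<open>Rigidity of standard chains\<close>

definition odd_zeros :: "int list \<Rightarrow> bool" where
  "odd_zeros ws \<longleftrightarrow> (\<exists>k. ws = replicate (2 * k + 1) 0)"

lemma odd_zeros_single: "odd_zeros [0]"
  unfolding odd_zeros_def by (intro exI[of _ 0]) simp

lemma odd_zeros_step: "odd_zeros ws \<Longrightarrow> odd_zeros (0 # 0 # ws)"
  unfolding odd_zeros_def by (elim exE, rule_tac x = "Suc k" in exI) simp

text \<open>\<open>as\<close> is a standard chain with weights \<open>w'\<close> between boundary
  entries \<open>a\<close> and \<open>b\<close>; \<open>L\<close> is the dominating chain with
  weights \<open>w\<close>, which blowups only lower. The last condition fixes the sign of
  \<open>f\<close> at the entry after \<open>a\<close>, which is \<open>b\<close> if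
  \<open>as\<close> is empty.\<close>

definition standard_refinement ::
    "('b \<Rightarrow> int) \<Rightarrow> ('b \<Rightarrow> int) \<Rightarrow> ('b \<Rightarrow> int) \<Rightarrow> ('b \<Rightarrow> int) \<Rightarrow> 'b \<Rightarrow> 'b list \<Rightarrow> 'b \<Rightarrow> 'b list \<Rightarrow> bool"
  where "standard_refinement f g w w' a as b L \<longleftrightarrow>
    refines f g (a # as @ [b]) L \<and> harmonic w' f (a # as @ [b]) \<and> harmonic w' g (a # as @ [b]) \<and>
    standard_left (map w' as) \<and> (\<forall>x\<in>set as. w x \<le> w' x) \<and> f (hd (as @ [b])) > 0"

lemma standard_refinement_negative:
  assumes "standard_refinement f g w w' a as b L" "f a = 0" "\<forall>x\<in>set as. w' x \<le> -2"
  shows "\<forall>x\<in>set (tl L). f x > 0"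
proof -
  obtain c T where T: "as @ [b] = c # T" by (cases as) auto
  have "\<forall>x\<in>set (c # T). f x > 0"
  proof (rule harmonic_increasing)
    show "\<forall>x\<in>set (butlast (c # T)). w' x \<le> -2" unfolding T[symmetric] using assms by simp
  qed (use assms T in \<open>auto simp: standard_refinement_def\<close>)
  then show ?thesis using refines_pos[of f g a "as @ [b]" L] assms T
    by (auto simp: standard_refinement_def)
qed

text \<open>Weight 0 at \<open>c\<close> negates the vector of \<open>a\<close> at \<open>z\<close>,
  so \<open>z\<close> is the first zero of \<open>f\<close> after \<open>a\<close>. Either
  \<open>z\<close> is the right boundary, or a second weight 0, at \<open>z\<close>, negates the
  vector of \<open>c\<close> at the next entry and the argument restarts at \<open>z\<close> with
  \<open>f\<close> negated.\<close>

lemma standard_refinement_zero: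
  assumes "standard_refinement f g w w' a as b L" "f a = 0" "\<not> (\<forall>x\<in>set as. w' x \<le> -2)"
  obtains c G H z L' where "L = a # G @ c # H @ z # L'" "fill f g a G c" "fill f g c H z"
    "f z = 0" "g z = - g a" "f c > 0" "\<forall>x\<in>set (G @ c # H). f x > 0"
    "(as = [c] \<and> z = b \<and> L' = [] \<and> odd_zeros (map w' as)) \<or>
     (\<exists>as'. as = c # z # as' \<and> (odd_zeros (map w' as') \<longrightarrow> odd_zeros (map w' as)) \<and>
       standard_refinement (\<lambda>x. - f x) g w w' z as' b (z # L') \<and>
       f (hd (as' @ [b])) = - f c \<and> g (hd (as' @ [b])) = - g c)"
proof -
  note sr = assms(1)[unfolded standard_refinement_def]
  have "standard_left (map w' as)" using sr by blast
  then have "\<exists>c z T. as @ [b] = c # z # T \<and> w' c = 0 \<and>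
      ((as = [c] \<and> z = b \<and> T = []) \<or>
       (\<exists>as'. as = c # z # as' \<and> T = as' @ [b] \<and> w' z = 0 \<and> standard_left (map w' as')))"
  proof (cases rule: standard_left_cases)
    case 1
    then show ?thesis using assms(3) by auto
  next
    case 2
    then show ?thesis by auto
  next
    case (3 ws')
    then obtain c z as' where "as = c # z # as'" "w' c = 0" "w' z = 0" "ws' = map w' as'"
      by (auto simp: map_eq_Cons_conv Cons_eq_map_conv)
    with 3 show ?thesis by auto
  qed
  then obtain c z T where T: "as @ [b] = c # z # T" "w' c = 0"
    "(as = [c] \<and> z = b \<and> T = []) \<or>
       (\<exists>as'. as = c # z # as' \<and> T = as' @ [b] \<and> w' z = 0 \<and> standard_left (map w' as'))"
    by blast
  have "refines f g (a # c # z # T) L" using sr T(1) by simp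
  then obtain G H L1 where L: "L = a # G @ c # H @ L1" "fill f g a G c" "fill f g c H z"
    "refines f g (z # T) L1" by auto
  obtain L' where L': "L1 = z # L'" using refines_Cons[OF L(4)] by blast
  have fc: "f c > 0" using sr T(1) by simp
  have hf: "harmonic w' f (a # c # z # T)" and hg: "harmonic w' g (a # c # z # T)"
    using sr T(1) by simp_all
  then have z: "f z = 0" "g z = - g a" using T(2) assms(2) by auto
  have pos: "f x > 0" if "x \<in> set (G @ c # H)" for x
    using that fill_pos[OF L(2), of x] fill_pos[OF L(3), of x] fc z assms(2) by auto
  show ?thesis
  proof (rule that[OF _ L(2,3) z fc])
    show "L = a # G @ c # H @ z # L'" using L(1) L' by simp
    show "\<forall>x\<in>set (G @ c # H). f x > 0" using pos by blast
    from T(3) show "(as = [c] \<and> z = b \<and> L' = [] \<and> odd_zeros (map w' as)) \<or>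
     (\<exists>as'. as = c # z # as' \<and> (odd_zeros (map w' as') \<longrightarrow> odd_zeros (map w' as)) \<and>
       standard_refinement (\<lambda>x. - f x) g w w' z as' b (z # L') \<and>
       f (hd (as' @ [b])) = - f c \<and> g (hd (as' @ [b])) = - g c)"
    proof (elim disjE exE conjE)
      assume "as = [c]" "z = b" "T = []"
      then show ?thesis using L(4) L' T(2) odd_zeros_single by auto
    next
      fix as' assume as': "as = c # z # as'" "T = as' @ [b]" "w' z = 0" "standard_left (map w' as')"
      obtain d T' where d: "as' @ [b] = d # T'" by (cases as') auto
      have fd: "f d = - f c" "g d = - g c" using hf hg as' d by auto
      have "standard_refinement (\<lambda>x. - f x) g w w' z as' b (z # L')"
        unfolding standard_refinement_def
        using refines_uminus[OF L(4)] hf hg as' L' d fd fc sr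
        by (auto intro!: harmonic_uminus)
      moreover have "odd_zeros (map w' as') \<longrightarrow> odd_zeros (map w' as)"
        using odd_zeros_step as' T(2) by simp
      ultimately show ?thesis using as' fd d by auto
    qed
  qed
qed

lemma first_zero_unique:
  fixes f :: "'b \<Rightarrow> int"
  assumes "P @ z # Q = P' @ z' # Q'" "f z = 0" "f z' = 0"
    "\<forall>x\<in>set P. f x > 0" "\<forall>x\<in>set P'. f x > 0"
  shows "P = P' \<and> z = z' \<and> Q = Q'"
  using assms
proof (induction P arbitrary: P')
  case Nil
  then show ?case by (cases P') auto
next
  case (Cons x P)
  then obtain P'' where "P' = x # P''" by (cases P') auto
  with Cons show ?case by simp
qed

text \<open>\<open>cs\<close> stands for the other chain. A proper refinement would contain a -1
  vertex outside \<open>as\<close>, which could lie only in \<open>cs\<close>, where no weight is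
  -1.\<close>

lemma standard_refinement_negative_trivial:
  assumes "standard_refinement f g w w' a as b L" "f a = 0" "\<forall>x\<in>set (tl L). f x > 0"
    "distinct L" "harmonic w f L"
    "\<forall>x\<in>set cs. w x \<noteq> -1" "\<forall>x\<in>set L. w x = -1 \<longrightarrow> x \<in> set (a # as @ [b]) \<union> set cs"
  shows "a # as @ [b] = L"
proof (rule ccontr)
  assume "a # as @ [b] \<noteq> L"
  then obtain x where "x \<in> set L" "w x = -1" "x \<notin> set (a # as @ [b])"
    using refines_minus_one[of f g "a # as @ [b]" L w] assms(1,3-5)
    unfolding standard_refinement_def by blast
  then show False using assms(6,7) by blast
qed

text \<open>Induction removes two leading zeros from both chains at once and moves the left boundary
  from \<open>a\<close> to \<open>z\<close>. Excluding two odd groups of zeros prevents both chains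
  from stopping at \<open>z\<close>; \<open>g a \<noteq> 0\<close> keeps the boundary vector nonzero
  although \<open>f a = 0\<close>.\<close>

lemma standard_refinement_rigid:
  assumes "distinct L" "harmonic w f L"
    "standard_refinement f g w wA a as b L" "standard_refinement f g w wB a bs b L"
    "\<not> (odd_zeros (map wA as) \<and> odd_zeros (map wB bs))"
    "\<forall>x\<in>set L. w x = -1 \<longrightarrow> x \<in> set (a # as @ [b]) \<union> set bs"
    "f a = 0" "g a \<noteq> 0"
  shows "a # as @ [b] = L \<and> a # bs @ [b] = L"
  using assms
proof (induction "length as" arbitrary: L f a as bs rule: less_induct)
  case less
  note prems = less.prems
  show ?case
  proof (cases "(\<forall>x\<in>set as. wA x \<le> -2) \<or> (\<forall>x\<in>set bs. wB x \<le> -2)")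
    case True
    then have pos: "\<forall>x\<in>set (tl L). f x > 0"
      using standard_refinement_negative[OF prems(3,7)] standard_refinement_negative[OF prems(4,7)]
      by (elim disjE) assumption+
    \<comment> \<open>A leading zero in either chain would produce a further zero of
      \<open>f\<close> in \<open>L\<close>.\<close>
    have no_zero: "\<forall>x\<in>set cs. w' x \<le> -2"
      if sr: "standard_refinement f g w w' a cs b L" for w' cs
    proof (rule ccontr)
      assume "\<not> (\<forall>x\<in>set cs. w' x \<le> -2)"
      then show False
        by (rule standard_refinement_zero[OF sr prems(7)]) (use pos in auto)
    qed
    have "w x \<noteq> -1" if "standard_refinement f g w w' a cs b L" "x \<in> set cs" for w' cs x
    proof -
      have "w x \<le> w' x" using that unfolding standard_refinement_def by blast
      moreover have "w' x \<le> -2" using no_zero[OF that(1)] that(2) by blast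
      ultimately show ?thesis by simp
    qed
    then have neq: "\<forall>x\<in>set as. w x \<noteq> -1" "\<forall>x\<in>set bs. w x \<noteq> -1"
      by (intro ballI, use prems(3,4) in blast)+
    show ?thesis
    proof
      show "a # as @ [b] = L"
        by (rule standard_refinement_negative_trivial[OF prems(3,7) pos prems(1,2) neq(2) prems(6)])
      show "a # bs @ [b] = L"
        by (rule standard_refinement_negative_trivial[OF prems(4,7) pos prems(1,2) neq(1)])
          (use prems(6) in auto)
    qed
  next
    case False
    then have notneg: "\<not> (\<forall>x\<in>set as. wA x \<le> -2)" "\<not> (\<forall>x\<in>set bs. wB x \<le> -2)" by auto
    obtain c G H z L' where A: "L = a # G @ c # H @ z # L'" "fill f g a G c" "fill f g c H z"
      "f z = 0" "g z = - g a" "f c > 0" "\<forall>x\<in>set (G @ c # H). f x > 0"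
      "(as = [c] \<and> z = b \<and> L' = [] \<and> odd_zeros (map wA as)) \<or>
       (\<exists>as'. as = c # z # as' \<and> (odd_zeros (map wA as') \<longrightarrow> odd_zeros (map wA as)) \<and>
         standard_refinement (\<lambda>x. - f x) g w wA z as' b (z # L') \<and>
         f (hd (as' @ [b])) = - f c \<and> g (hd (as' @ [b])) = - g c)"
      by (rule standard_refinement_zero[OF prems(3,7) notneg(1)]) (rule that, assumption+)
    obtain d K J y M' where B: "L = a # K @ d # J @ y # M'" "fill f g a K d" "fill f g d J y"
      "f y = 0" "g y = - g a" "f d > 0" "\<forall>x\<in>set (K @ d # J). f x > 0"
      "(bs = [d] \<and> y = b \<and> M' = [] \<and> odd_zeros (map wB bs)) \<or>
       (\<exists>bs'. bs = d # y # bs' \<and> (odd_zeros (map wB bs') \<longrightarrow> odd_zeros (map wB bs)) \<and>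
         standard_refinement (\<lambda>x. - f x) g w wB y bs' b (y # M') \<and>
         f (hd (bs' @ [b])) = - f d \<and> g (hd (bs' @ [b])) = - g d)"
      by (rule standard_refinement_zero[OF prems(4,7) notneg(2)]) (rule that, assumption+)
    \<comment> \<open>Both \<open>z\<close> and \<open>y\<close> are the first zero of
      \<open>f\<close> beyond \<open>a\<close> in \<open>L\<close>.\<close>
    have eq: "G @ c # H = K @ d # J" "y = z" "M' = L'"
      using first_zero_unique[of "G @ c # H" z L' "K @ d # J" y M' f] A B by auto
    \<comment> \<open>If one chain continues beyond \<open>z\<close>, then the other cannot stop
      there; if both stopped, both would be odd groups of zeros.\<close>
    have "L' \<noteq> []" if "standard_refinement f' g w w' z cs b (z # L')" for f' w' cs
    proof -
      have "refines f' g (z # cs @ [b]) (z # L')" using that by (simp add: standard_refinement_def)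
      then show ?thesis using refines_Cons by (cases cs) fastforce+
    qed
    with A(8) B(8) prems(5) eq obtain as' bs' where
      as': "as = c # z # as'" "odd_zeros (map wA as') \<longrightarrow> odd_zeros (map wA as)"
        "standard_refinement (\<lambda>x. - f x) g w wA z as' b (z # L')"
        "f (hd (as' @ [b])) = - f c" "g (hd (as' @ [b])) = - g c" and
      bs': "bs = d # z # bs'" "odd_zeros (map wB bs') \<longrightarrow> odd_zeros (map wB bs)"
        "standard_refinement (\<lambda>x. - f x) g w wB z bs' b (z # L')"
        "f (hd (bs' @ [b])) = - f d" "g (hd (bs' @ [b])) = - g d"
      by blast
    have tails: "z # as' @ [b] = z # L' \<and> z # bs' @ [b] = z # L'"
    proof (rule less.hyps[OF _ _ _ as'(3) bs'(3)])
      show "length as' < length as" using as'(1) by simp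
      show "distinct (z # L')" using prems(1) A(1) by simp
      show "harmonic w (\<lambda>x. - f x) (z # L')"
      proof (rule harmonic_uminus, rule harmonic_appendD2)
        show "harmonic w f ((a # G @ c # H) @ z # L')" using prems(2) A(1) by simp
      qed
      show "\<not> (odd_zeros (map wA as') \<and> odd_zeros (map wB bs'))"
        using as'(2) bs'(2) prems(5) by blast
      \<comment> \<open>Entries from \<open>z\<close> on differ from \<open>a\<close>,
        \<open>c\<close> and \<open>d\<close>, so a -1 vertex among them lies in one of the two
        tails.\<close>
      have "set (z # L') \<inter> set (a # K @ d # J) = {}" "set (z # L') \<inter> set (a # G @ c # H) = {}"
        using prems(1) A(1) eq(1) by (auto simp flip: eq(1)) 
      then show "\<forall>x\<in>set (z # L'). w x = - 1 \<longrightarrow> x \<in> set (z # as' @ [b]) \<union> set bs'"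
        using prems(6) A(1) as'(1) bs'(1) by auto
    qed (use A(4,5) prems(8) in auto)
    then have "as' = bs'" by auto
    \<comment> \<open>The entries following \<open>z\<close> coincide, and their vectors are the
      negatives of those of \<open>c\<close> and \<open>d\<close>.\<close>
    then have fg: "f c = f d" "g c = g d" using as' bs' by auto
    \<comment> \<open>Otherwise \<open>c\<close> is inserted between \<open>a\<close> and
      \<open>d\<close> or between \<open>d\<close> and \<open>z\<close>. As \<open>f\<close>
      vanishes at \<open>a\<close> and \<open>z\<close>, \<open>f c = f d\<close> makes the
      coefficient of \<open>d\<close> equal to 1; then \<open>g c = g d\<close> contradicts
      \<open>g a \<noteq> 0\<close>.\<close>
    have "c = d"
    proof (rule ccontr)
      assume "c \<noteq> d"
      have "c \<in> set (K @ d # J)" unfolding eq(1)[symmetric] by simp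
      with \<open>c \<noteq> d\<close> consider "c \<in> set K" | "c \<in> set J" by auto
      then show False
      proof cases
        case 1
        then obtain \<alpha> \<beta> where "\<alpha> \<ge> 1" "f c = \<alpha> * f a + \<beta> * f d" "g c = \<alpha> * g a + \<beta> * g d"
          using fill_combination[OF B(2)] by metis
        then show False using fg prems(7,8) B(6) by auto
      next
        case 2
        then obtain \<alpha> \<beta> where "\<beta> \<ge> 1" "f c = \<alpha> * f d + \<beta> * f y" "g c = \<alpha> * g d + \<beta> * g y"
          using fill_combination[OF B(3)] by metis
        then show False using fg B(4,5) prems(8) B(6) by auto
      qed
    qed
    \<comment> \<open>A nonempty gap beside \<open>c\<close> would contain a -1 vertex of neither
      chain: both contain \<open>c\<close>, and their other vertices lie outside the gap.\<close>
    have nomid: "X = []" if fl: "fill f g s X t" and L: "L = P @ s # X @ t # Q"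
      and X: "set X \<subseteq> set (G @ c # H)" "c \<notin> set X" for s X t P Q
    proof (rule ccontr)
      assume "X \<noteq> []"
      have "harmonic w f (P @ ((s # X @ [t]) @ Q))" using prems(2) L by simp
      then have "harmonic w f (s # X @ [t])" using harmonic_appendD1 harmonic_appendD2 by blast
      then obtain x where x: "x \<in> set X" "w x = -1"
        using fill_minus_one[OF fl \<open>X \<noteq> []\<close>] A(7) X(1) by blast
      have "x \<notin> set (a # z # L')" using x(1) X(1) prems(1) A(1) by auto
      moreover have "b \<in> set (z # L')" "set as' \<subseteq> set L'" "set bs' \<subseteq> set L'"
        using conjunct1[OF tails, symmetric] conjunct2[OF tails, symmetric] by auto
      moreover have "x \<noteq> c" using x(1) X(2) by auto
      moreover have "x \<in> set L" using x L by auto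
      ultimately show False using prems(6) x(2) as'(1) bs'(1) \<open>c = d\<close> by auto
    qed
    have "G = []" by (rule nomid[OF A(2), of "[]" "H @ z # L'"]) (use A(1) prems(1) in auto)
    moreover have "H = []" by (rule nomid[OF A(3), of "a # G" L']) (use A(1) prems(1) in auto)
    ultimately show ?thesis using A(1) as'(1) bs'(1) tails \<open>c = d\<close> by auto
  qed
qed


section \<open>Harmonic functions under a blowdown\<close>

text \<open>Weight -1 at \<open>x\<close> turns its equation into \<open>f x = f u + f v\<close>;
  substituting this in the equations at \<open>u\<close> and \<open>v\<close> raises their weights
  by 1.\<close>

lemma harmonic_blowdown:
  assumes "harmonic w' f (xs @ u # x # v # ys)" "distinct (xs @ u # x # v # ys)" "w' x = -1"
    "\<forall>y\<in>set (butlast (tl (xs @ u # v # ys))). w y = w' y + (if y = u \<or> y = v then 1 else 0)"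
  shows "harmonic w f (xs @ u # v # ys) \<and> f x = f u + f v"
proof -
  have h1: "harmonic w' f (xs @ [u, x])" and "harmonic w' f (u # x # v # ys)"
    using assms(1) harmonic_append[of w' f xs u x "v # ys"] by simp_all
  then have h2: "harmonic w' f (x # v # ys)" and fx: "f x = f u + f v"
    using assms(3) by auto
  have "harmonic w f (xs @ [u, v])"
  proof (cases xs rule: rev_cases)
    case (snoc zs a)
    have "harmonic w' f (zs @ [a, u])" "harmonic w' f [a, u, x]"
      using h1 harmonic_append[of w' f zs a u "[x]"] unfolding snoc by auto
    moreover have wu: "w u = w' u + 1" using assms(4) unfolding snoc
      by (cases zs) (auto simp: butlast_append)
    moreover have "harmonic w f (zs @ [a, u])"
      by (rule harmonic_cong[OF \<open>harmonic w' f (zs @ [a, u])\<close>])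
        (use assms(2,4) snoc in \<open>cases zs; auto simp: butlast_append\<close>)
    ultimately show ?thesis using fx harmonic_append[of w f zs a u "[v]"] unfolding snoc
      by (auto simp: algebra_simps)
  qed simp
  moreover have "harmonic w f (u # v # ys)"
  proof (cases ys)
    case (Cons c zs)
    have "w v = w' v + 1" using assms(4) unfolding Cons
      by (cases xs) (auto simp: butlast_append)
    moreover have h3: "harmonic w' f (v # c # zs)" using h2 unfolding Cons by simp
    moreover have "harmonic w f (v # c # zs)"
    proof (rule harmonic_cong[OF h3])
      fix y assume y: "y \<in> set (butlast (tl (v # c # zs)))"
      then have "y \<in> set (butlast (tl (xs @ u # v # ys)))"
        unfolding Cons by (cases xs) (auto simp: butlast_append)
      moreover have "y \<in> set ys" using y in_set_butlastD unfolding Cons by fastforce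
      then have "y \<noteq> u" "y \<noteq> v" using assms(2) by auto
      ultimately show "w y = w' y" using assms(4) by simp
    qed
    ultimately show ?thesis using h2 fx unfolding Cons by (auto simp: algebra_simps)
  qed simp
  ultimately show ?thesis using fx harmonic_append[of w f xs u v ys] by simp
qed

section \<open>Blowups of linear chains\<close>

fun path_edges :: "'a list \<Rightarrow> 'a set set" where
  "path_edges (x # y # zs) = insert {x, y} (path_edges (y # zs))"
| "path_edges _ = {}"

lemma path_edges_nth: "path_edges vs = {{vs ! i, vs ! Suc i} | i. Suc i < length vs}"
proof (induction vs rule: path_edges.induct)
  case (1 x y zs)
  have "{{(x # y # zs) ! i, (x # y # zs) ! Suc i} | i. Suc i < length (x # y # zs)} =
    insert {x, y} {{(y # zs) ! i, (y # zs) ! Suc i} | i. Suc i < length (y # zs)}"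
    (is "?l = insert _ ?r")
  proof (intro equalityI subsetI)
    fix e assume "e \<in> ?l"
    then obtain i where "Suc i < length (x # y # zs)" "e = {(x # y # zs) ! i, (x # y # zs) ! Suc i}"
      by blast
    then show "e \<in> insert {x, y} ?r" by (cases i) auto
  next
    fix e assume "e \<in> insert {x, y} ?r"
    then consider "e = {x, y}"
      | i where "Suc i < length (y # zs)" "e = {(y # zs) ! i, (y # zs) ! Suc i}" by blast
    then show "e \<in> ?l"
    proof cases
      case 1
      then show ?thesis by (intro CollectI exI[of _ 0]) simp
    next
      case 2
      then show ?thesis by (intro CollectI exI[of _ "Suc i"]) simp
    qed
  qed
  with 1 show ?case by simp
qed auto

lemma chain_ordering_path_edges:
  "chain_ordering G vs \<longleftrightarrow>
    vs \<noteq> [] \<and> distinct vs \<and> set vs = verts G \<and> edges G = path_edges vs"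
  unfolding chain_ordering_def path_edges_nth ..

lemma path_edges_subset: "e \<in> path_edges vs \<Longrightarrow> e \<subseteq> set vs"
  by (induction vs rule: path_edges.induct) auto

lemma path_edges_append:
  "path_edges (as @ bs) = path_edges as \<union> path_edges bs \<union>
    (if as = [] \<or> bs = [] then {} else {{last as, hd bs}})"
proof (induction as rule: path_edges.induct)
  case ("2_2" a)
  then show ?case by (cases bs) auto
qed auto

lemma path_edges_Cons:
  "path_edges (p # bs) = path_edges bs \<union> (if bs = [] then {} else {{p, hd bs}})"
  by (cases bs) auto

lemma path_edges_middle:
  "path_edges (as @ p # bs) = path_edges as \<union> path_edges bs \<union>
    (if as = [] then {} else {{last as, p}}) \<union> (if bs = [] then {} else {{p, hd bs}})"
  by (auto simp: path_edges_append path_edges_Cons)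

text \<open>Lets relative minimality be applied to every vertex of weight -1 of a chain.\<close>

lemma chain_degree_le_2:
  assumes "chain_ordering G vs" "v \<in> verts G"
  shows "degree G v \<le> 2"
proof -
  obtain as bs where vs: "vs = as @ v # bs"
    using assms split_list unfolding chain_ordering_def by metis
  have "v \<notin> set as" "v \<notin> set bs" using assms(1) vs unfolding chain_ordering_def by auto
  \<comment> \<open>At an end of the path \<open>last as\<close> or \<open>hd bs\<close> is an
    unspecified value, harmless in an upper bound.\<close>
  then have "{e \<in> edges G. v \<in> e} \<subseteq> {{last as, v}, {v, hd bs}}"
    using assms(1) path_edges_subset[of _ as] path_edges_subset[of _ bs]
    unfolding chain_ordering_path_edges vs path_edges_middle by (auto split: if_splits)
  then have "degree G v \<le> card {{last as, v}, {v, hd bs}}"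
    unfolding degree_def by (intro card_mono) auto
  also have "\<dots> \<le> 2" by (simp add: card_insert_if)
  finally show ?thesis .
qed

section \<open>Single blowups that result in a chain\<close>

text \<open>The record does not tie edges to vertices; this ensures that a new vertex has only the
  edges created by its blowup.\<close>

definition edges_in_verts :: "'a wgraph \<Rightarrow> bool" where
  "edges_in_verts G \<longleftrightarrow> (\<forall>e\<in>edges G. e \<subseteq> verts G)"

lemma blowup_edges_in_verts: "blowup H G \<Longrightarrow> edges_in_verts H \<Longrightarrow> edges_in_verts G"
  by (induction rule: blowup.induct) (auto simp: edges_in_verts_def verts_def)

text \<open>Treats both kinds of blowup alike: \<open>N\<close> is the set of neighbours of the new vertex \<open>p\<close>.\<close>

lemma blowup_neighbours:
  assumes "blowup H G" "edges_in_verts H"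
  obtains p N where "p \<notin> verts H" "verts G = insert p (verts H)" "weight G p = -1"
    "N \<noteq> {}" "N \<subseteq> verts H" "{a. {a, p} \<in> edges G} = N"
    "\<forall>a\<in>verts H. weight H a = weight G a + (if a \<in> N then 1 else 0)"
    "(\<exists>u v. N = {u, v} \<and> u \<noteq> v \<and> edges H = insert {u, v} {e \<in> edges G. p \<notin> e}) \<or>
     (\<exists>v. N = {v} \<and> edges H = {e \<in> edges G. p \<notin> e})"
  using assms(1)
proof cases
  case (inner u v x)
  have no_x: "x \<notin> e" if "e \<in> edges H" for e
    using that inner(6) assms(2) unfolding edges_in_verts_def by blast
  have E: "edges G = (edges H - {{u, v}}) \<union> {{u, x}, {x, v}}" unfolding inner(1) by simp
  show ?thesis
  proof (rule that[of x "{u, v}"])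
    show "{a. {a, x} \<in> edges G} = {u, v}"
      unfolding E using no_x by (auto simp: doubleton_eq_iff)
    have "{e \<in> edges G. x \<notin> e} = edges H - {{u, v}}" unfolding E using no_x by auto
    then have "edges H = insert {u, v} {e \<in> edges G. x \<notin> e}" using inner(2) by auto
    then show "(\<exists>a b. {u, v} = {a, b} \<and> a \<noteq> b \<and> edges H = insert {a, b} {e \<in> edges G. x \<notin> e}) \<or>
      (\<exists>a. {u, v} = {a} \<and> edges H = {e \<in> edges G. x \<notin> e})"
      using inner(5) by blast
    show "verts G = insert x (verts H)"
      using inner(3,4) unfolding inner(1) by (auto simp: verts_def)
    show "\<forall>a\<in>verts H. weight H a = weight G a + (if a \<in> {u, v} then 1 else 0)"
      using inner(5,6) unfolding inner(1) by (auto simp: weight_def)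
  qed (use inner in \<open>auto simp: weight_def\<close>)
next
  case (outer v x)
  have no_x: "x \<notin> e" if "e \<in> edges H" for e
    using that outer(3) assms(2) unfolding edges_in_verts_def by blast
  have E: "edges G = edges H \<union> {{v, x}}" unfolding outer(1) by simp
  show ?thesis
  proof (rule that[of x "{v}"])
    show "{a. {a, x} \<in> edges G} = {v}"
      unfolding E using no_x by (auto simp: doubleton_eq_iff)
    have "{e \<in> edges G. x \<notin> e} = edges H" unfolding E using no_x by auto
    then show "(\<exists>a b. {v} = {a, b} \<and> a \<noteq> b \<and> edges H = insert {a, b} {e \<in> edges G. x \<notin> e}) \<or>
      (\<exists>a. {v} = {a} \<and> edges H = {e \<in> edges G. x \<notin> e})"
      by blast
    show "verts G = insert x (verts H)"
      using outer(2) unfolding outer(1) by (auto simp: verts_def)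
    show "\<forall>a\<in>verts H. weight H a = weight G a + (if a \<in> {v} then 1 else 0)"
      using outer(3) unfolding outer(1) by (auto simp: weight_def)
  qed (use outer in \<open>auto simp: weight_def\<close>)
qed

datatype 'a ext = Lo | Mid 'a | Hi

text \<open>The sentinels turn an outer blowup at an end of the chain into the insertion of a vertex
  between two consecutive ones.  Their weights never matter.\<close>

abbreviation extend :: "'a list \<Rightarrow> 'a ext list" where
  "extend vs \<equiv> Lo # map Mid vs @ [Hi]"

fun ext_weight :: "'a wgraph \<Rightarrow> 'a ext \<Rightarrow> int" where
  "ext_weight G (Mid v) = weight G v"
| "ext_weight G _ = 0"

text \<open>The new vertex \<open>p\<close> has exactly the neighbours \<open>N\<close> in the path:
  two for an inner blowup, one for an outer blowup, which therefore happens at an end, with a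
  sentinel on the other side of \<open>p\<close>.\<close>

lemma blowup_chain:
  assumes "blowup H G" "edges_in_verts H" "chain_ordering G vs"
  shows "chain_ordering H (induced_ordering vs H) \<and>
    (\<exists>xs u x v ys. extend vs = xs @ u # x # v # ys \<and>
      extend (induced_ordering vs H) = xs @ u # v # ys \<and> ext_weight G x = -1 \<and>
      (\<forall>y\<in>Mid ` verts H. ext_weight H y = ext_weight G y + (if y = u \<or> y = v then 1 else 0)))"
proof -
  obtain p N where p: "p \<notin> verts H" "verts G = insert p (verts H)" "weight G p = -1"
    "N \<noteq> {}" "N \<subseteq> verts H" "{a. {a, p} \<in> edges G} = N"
    "\<forall>a\<in>verts H. weight H a = weight G a + (if a \<in> N then 1 else 0)"
    "(\<exists>u v. N = {u, v} \<and> u \<noteq> v \<and> edges H = insert {u, v} {e \<in> edges G. p \<notin> e}) \<or>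
     (\<exists>v. N = {v} \<and> edges H = {e \<in> edges G. p \<notin> e})"
    using blowup_neighbours[OF assms(1,2)] .
  note vs = assms(3)[unfolded chain_ordering_path_edges]
  obtain as bs where ab: "vs = as @ p # bs"
    using vs p(2) split_list by (metis insertI1)
  have dist: "distinct (as @ p # bs)" and set: "set (as @ bs) = verts H"
    using vs ab p(1,2) by auto
  have filter: "induced_ordering vs H = as @ bs"
  proof -
    have "filter (\<lambda>v. v \<in> verts H) as = as" "filter (\<lambda>v. v \<in> verts H) bs = bs"
      using set by (auto simp: filter_id_conv)
    then show ?thesis using p(1) unfolding induced_ordering_def ab by simp
  qed
  have no_p: "p \<notin> e" if "e \<in> path_edges as \<or> e \<in> path_edges bs" for e
    using that path_edges_subset[of e as] path_edges_subset[of e bs] dist by auto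
  have edges: "edges G = path_edges (as @ p # bs)" using vs ab by simp
  have N: "N = (if as = [] then {} else {last as}) \<union> (if bs = [] then {} else {hd bs})"
    unfolding p(6)[symmetric] edges path_edges_middle
    using no_p by (auto simp: doubleton_eq_iff split: if_splits)
  have E: "{e \<in> edges G. p \<notin> e} = path_edges as \<union> path_edges bs"
    unfolding edges path_edges_middle using no_p by auto
  have "last as \<noteq> hd bs" if "as \<noteq> []" "bs \<noteq> []"
    using dist last_in_set[OF that(1)] hd_in_set[OF that(2)] by auto
  then have "edges H = path_edges (as @ bs)"
    using p(8) unfolding N E path_edges_append
    by (auto simp: doubleton_eq_iff insert_commute split: if_splits)
  moreover have "as @ bs \<noteq> []" using p(4) N by (auto split: if_splits)
  ultimately have "chain_ordering H (as @ bs)"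
    using set dist unfolding chain_ordering_path_edges by auto
  moreover
  \<comment> \<open>The parents of \<open>Mid p\<close> are the last entry of \<open>?l\<close> and
    the first of \<open>?r\<close>; these are \<open>Lo\<close> if \<open>as\<close> is empty and
    \<open>Hi\<close> if \<open>bs\<close> is empty.\<close>
  let ?l = "Lo # map Mid as" and ?r = "map Mid bs @ [Hi]"
  have "extend vs = butlast ?l @ last ?l # Mid p # hd ?r # tl ?r"
    unfolding ab by (cases bs) (auto simp flip: append_butlast_last_id simp del: butlast.simps last.simps)
  moreover have "extend (as @ bs) = butlast ?l @ last ?l # hd ?r # tl ?r"
    by (cases bs) (auto simp flip: append_butlast_last_id simp del: butlast.simps last.simps)
  moreover have mid: "Mid a = last ?l \<or> Mid a = hd ?r \<longleftrightarrow> a \<in> N" for a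
    unfolding N by (cases bs) (auto simp: last_map)
  have "\<forall>y\<in>Mid ` verts H.
    ext_weight H y = ext_weight G y + (if y = last ?l \<or> y = hd ?r then 1 else 0)"
    using p(7) by (simp only: ball_simps mid ext_weight.simps)
  moreover have "ext_weight G (Mid p) = -1" using p(3) by simp
  ultimately show ?thesis unfolding filter by blast
qed

section \<open>Sequences of blowups\<close>

lemma induced_ordering_trans:
  "verts H \<subseteq> verts G \<Longrightarrow> induced_ordering (induced_ordering vs G) H = induced_ordering vs H"
  unfolding induced_ordering_def by (auto intro!: filter_cong)

text \<open>Blowups are undone one at a time, starting from \<Gamma>. The same \<open>f\<close> and
  \<open>g\<close> stay harmonic throughout, so every removed entry carries the sum of its
  neighbours; the weights of the remaining vertices never decrease.\<close>

lemma blowups_refine: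
  assumes "blowup\<^sup>*\<^sup>* H \<Gamma>" "edges_in_verts H" "chain_ordering \<Gamma> vs"
    "harmonic (ext_weight \<Gamma>) f (extend vs)" "harmonic (ext_weight \<Gamma>) g (extend vs)"
  shows "chain_ordering H (induced_ordering vs H) \<and> verts H \<subseteq> verts \<Gamma> \<and>
    (\<forall>v\<in>verts H. weight \<Gamma> v \<le> weight H v) \<and>
    refines f g (extend (induced_ordering vs H)) (extend vs) \<and>
    harmonic (ext_weight H) f (extend (induced_ordering vs H)) \<and>
    harmonic (ext_weight H) g (extend (induced_ordering vs H))"
  using assms
proof (induction rule: converse_rtranclp_induct)
  case base
  have "induced_ordering vs \<Gamma> = vs"
    using base unfolding induced_ordering_def chain_ordering_def by (auto simp: filter_id_conv)
  with base refines_refl show ?case by auto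
next
  case (step H G)
  have IH: "chain_ordering G (induced_ordering vs G)" "verts G \<subseteq> verts \<Gamma>"
    "\<forall>v\<in>verts G. weight \<Gamma> v \<le> weight G v"
    "refines f g (extend (induced_ordering vs G)) (extend vs)"
    "harmonic (ext_weight G) f (extend (induced_ordering vs G))"
    "harmonic (ext_weight G) g (extend (induced_ordering vs G))"
    using step.IH step.prems blowup_edges_in_verts[OF step.hyps(1)] by blast+
  obtain p N where p: "verts G = insert p (verts H)"
    "\<forall>a\<in>verts H. weight H a = weight G a + (if a \<in> N then 1 else 0)"
    using blowup_neighbours[OF step.hyps(1) step.prems(1)] by metis
  have sub: "verts H \<subseteq> verts G" using p(1) by blast
  have weights: "\<forall>v\<in>verts H. weight \<Gamma> v \<le> weight H v"
  proof
    fix v assume "v \<in> verts H"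
    then have "weight \<Gamma> v \<le> weight G v" "weight G v \<le> weight H v" using IH(3) sub p(2) by auto
    then show "weight \<Gamma> v \<le> weight H v" by linarith
  qed
  from blowup_chain[OF step.hyps(1) step.prems(1) IH(1), unfolded induced_ordering_trans[OF sub]]
  obtain xs u x v ys where c: "chain_ordering H (induced_ordering vs H)"
    "extend (induced_ordering vs G) = xs @ u # x # v # ys"
    "extend (induced_ordering vs H) = xs @ u # v # ys" "ext_weight G x = -1"
    "\<forall>y\<in>Mid ` verts H. ext_weight H y = ext_weight G y + (if y = u \<or> y = v then 1 else 0)"
    by blast
  have "distinct (extend (induced_ordering vs G))"
    using IH(1) unfolding chain_ordering_def by (auto simp: distinct_map inj_on_def)
  moreover have "set (butlast (tl (extend (induced_ordering vs H)))) = Mid ` verts H"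
    using c(1) unfolding chain_ordering_def by simp
  ultimately have "harmonic (ext_weight H) k (extend (induced_ordering vs H)) \<and> k x = k u + k v"
    if "harmonic (ext_weight G) k (extend (induced_ordering vs G))" for k
    using harmonic_blowdown[of "ext_weight G" k xs u x v ys "ext_weight H"] that c(2-5) by simp
  then show ?case
    using c(1,2,3) IH sub weights refines_remove[of f g xs u x v ys "extend vs"] by auto
qed

section \<open>Normalised vectors and comparison of the two chains\<close>

text \<open>As \<open>f a = 0\<close>, an entry inserted between \<open>a\<close> and
  \<open>c\<close> has value \<open>\<beta> * f c\<close> with \<open>\<beta> > 0\<close>. Thus the
  sign normalised at the first vertex of \<Gamma> carries over to the first vertices of the coarser
  chains.\<close>

lemma refines_second_pos:
  assumes "refines f g (a # c # T) L" "f a = 0" "f (hd (tl L)) > 0"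
  shows "f c > 0"
proof -
  obtain G L' where G: "L = a # G @ L'" "fill f g a G c" "refines f g (c # T) L'"
    using assms(1) by auto
  show ?thesis
  proof (cases G)
    case Nil
    obtain L'' where "L' = c # L''" using refines_Cons[OF G(3)] by blast
    then show ?thesis using G(1) Nil assms(3) by simp
  next
    case (Cons y G')
    then have "y \<in> set G" by simp
    obtain \<alpha> \<beta> where ab: "\<alpha> \<ge> 1" "\<beta> \<ge> 1" "f y = \<alpha> * f a + \<beta> * f c"
      "g y = \<alpha> * g a + \<beta> * g c"
      by (rule fill_combination[OF G(2) \<open>y \<in> set G\<close>])
    have "f y > 0" using assms(3) unfolding G(1) Cons by simp
    then have "0 < \<beta> * f c" using ab(3) assms(2) by simp
    moreover have "0 < \<beta>" using ab(2) by simp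
    ultimately show ?thesis by (rule zero_less_mult_pos)
  qed
qed

theorem proposition3p4:
  fixes \<Gamma> A B :: "'a wgraph" and vs :: "'a list"
  assumes "linear_chain \<Gamma>" and "linear_chain A" and "linear_chain B"
    and "dominates \<Gamma> A" and "dominates \<Gamma> B"
    and "relatively_minimal \<Gamma> A B"
    and "chain_ordering \<Gamma> vs"
    and "standard A" and "standard B"
    and "(\<forall>k. \<not> is_chain A (replicate (2 * k + 1) 0)) \<or>
         (\<forall>k. \<not> is_chain B (replicate (2 * k + 1) 0))"
    and "zeros_on_left A (induced_ordering vs A)"
    and "zeros_on_left B (induced_ordering vs B)"
  shows "domination_iso \<Gamma> A \<and> domination_iso \<Gamma> B"
proof -
  let ?w = "ext_weight \<Gamma>"
  have dist: "distinct (extend vs)"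
    using assms(7) unfolding chain_ordering_def by (auto simp: distinct_map inj_on_def)
  obtain l L where l: "extend vs = Lo # l # L" by (cases vs) auto
  \<comment> \<open>The initial vectors are \<open>(0, 1)\<close> at \<open>Lo\<close> and
    \<open>(1, 0)\<close> at the next entry.\<close>
  obtain f where f: "harmonic ?w f (extend vs)" "f Lo = 0" "f l = 1"
    unfolding l by (rule harmonic_exists[OF dist[unfolded l], of ?w 0 1])
  obtain g where g: "harmonic ?w g (extend vs)" "g Lo = 1"
    unfolding l by (rule harmonic_exists[OF dist[unfolded l], of ?w 1 0])
  have vertices: "set vs = verts \<Gamma>" using assms(7) unfolding chain_ordering_def by simp
  have map_weight: "map (ext_weight H) (map Mid us) = map (weight H) us" for H :: "'a wgraph" and us
    by simp
  have refinement:
    "standard_refinement f g ?w (ext_weight H) Lo (map Mid (induced_ordering vs H)) Hi (extend vs) \<and>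
      chain_ordering H (induced_ordering vs H) \<and> verts H \<subseteq> verts \<Gamma>"
    if H: "linear_chain H" "dominates \<Gamma> H" "zeros_on_left H (induced_ordering vs H)" for H
  proof -
    let ?us = "induced_ordering vs H"
    have "edges_in_verts H"
      using H(1) path_edges_subset
      unfolding linear_chain_def chain_ordering_path_edges edges_in_verts_def by metis
    then have *: "chain_ordering H ?us" "verts H \<subseteq> verts \<Gamma>"
      "\<forall>v\<in>verts H. weight \<Gamma> v \<le> weight H v" "refines f g (extend ?us) (extend vs)"
      "harmonic (ext_weight H) f (extend ?us)" "harmonic (ext_weight H) g (extend ?us)"
      using blowups_refine[OF _ _ assms(7) f(1) g(1)] H(2) unfolding dominates_def by blast+
    obtain c T where c: "map Mid ?us @ [Hi] = c # T" by (cases ?us) auto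
    have "f c > 0"
      using refines_second_pos[OF *(4)[unfolded c]] f unfolding l by simp
    then have "f (hd (map Mid ?us @ [Hi])) > 0" unfolding c by simp
    moreover have "\<forall>x\<in>set (map Mid ?us). ?w x \<le> ext_weight H x"
      using *(3) by (auto simp: induced_ordering_def)
    ultimately show ?thesis
      using * H(3) unfolding standard_refinement_def zeros_on_left_def map_weight by blast
  qed
  note RA = refinement[OF assms(2,4,11)] and RB = refinement[OF assms(3,5,12)]
  have "\<not> (odd_zeros (map (ext_weight A) (map Mid (induced_ordering vs A))) \<and>
    odd_zeros (map (ext_weight B) (map Mid (induced_ordering vs B))))"
    using assms(10) RA RB unfolding odd_zeros_def is_chain_def map_weight by blast
  moreover have "\<forall>x\<in>set (extend vs). ?w x = -1 \<longrightarrow>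
    x \<in> set (extend (induced_ordering vs A)) \<union> set (map Mid (induced_ordering vs B))"
  proof (intro ballI impI)
    fix x assume x: "x \<in> set (extend vs)" "?w x = -1"
    \<comment> \<open>Sentinels have weight 0, so an entry of weight -1 is a vertex of
      \<Gamma>.\<close>
    then obtain v where v: "x = Mid v" "v \<in> verts \<Gamma>" "weight \<Gamma> v = -1" using vertices by auto
    with assms(6) chain_degree_le_2[OF assms(7) v(2)] have "v \<in> verts A \<or> v \<in> verts B"
      unfolding relatively_minimal_def contracted_def by auto
    with v vertices show
      "x \<in> set (extend (induced_ordering vs A)) \<union> set (map Mid (induced_ordering vs B))"
      by (auto simp: induced_ordering_def)
  qed
  ultimately have "extend (induced_ordering vs A) = extend vs \<and> extend (induced_ordering vs B) = extend vs"
    by (intro standard_refinement_rigid[OF dist f(1) conjunct1[OF RA] conjunct1[OF RB] _ _ f(2)])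
      (use g(2) in auto)
  moreover have "verts \<Gamma> \<subseteq> verts H" if "extend (induced_ordering vs H) = extend vs" for H :: "'a wgraph"
  proof -
    have "map Mid (induced_ordering vs H) = map Mid vs" using that by simp
    then have "set (induced_ordering vs H) = set vs"
      by (metis ext.inject injI list.inj_map_strong)
    then show ?thesis using vertices unfolding induced_ordering_def by auto
  qed
  ultimately show ?thesis
    using assms(4,5) unfolding domination_iso_def contracted_def by blast
qed

end
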